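(* Let $\phi:\mathbb{R}\times\mathbb{R}^n\to\mathbb{R}^m$ be such that $t\mapsto\phi(t,x)$ is locally integrable for each $x$, and suppose that $x\mapsto\phi(t,x)$ is continuous uniformly in $t$. Then $\phi$ is u$\delta$-PE with respect to $x_1$ if and only if for each $x\in\mathcal{D}_1$ there exist $T>0$ and $\mu>0$ such that, for all $t\in\mathbb{R}$, $$\int_t^{t+T}|\phi(\tau,x)|\,d\tau\ge\mu.$$
   Context: $|\cdot|$ is the Euclidean norm. $x\in\mathbb{R}^n$ is partitioned as $x=\mathrm{col}[x_1,x_2]$ with $x_1\in\mathbb{R}^{n_1}$, $x_2\in\mathbb{R}^{n_2}$, and $\mathcal{D}_1:=(\mathbb{R}^{n_1}\setminus\{0\})\times\mathbb{R}^{n_2}$. $\phi$, with $t\mapsto\phi(t,x)$ locally integrable, is u$\delta$-PE (uniformly $\delta$-persistently exciting) with respect to $x_1$ if for each $x\in\mathcal{D}_1$ there exist $\delta>0$, $T>0$, $\mu>0$ such that for all $t\in\mathbb{R}$: $|z-x|\le\delta$ implies $\int_t^{t+T}|\phi(\tau,z)|\,d\tau\ge\mu$. "$x\mapsto\phi(t,x)$ is continuous uniformly in $t$" means: for each $x$ and each $\varepsilon>0$ there is $\delta>0$ such that $|z-x|\le\delta$ implies $|\phi(t,z)-\phi(t,x)|\le\varepsilon$ for all $t\in\mathbb{R}$. *)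

theory Defs
  imports "HOL-Analysis.Analysis"
begin

text \<open>
  The partition \<open>x = col[x1, x2]\<close> of a vector \<open>x :: real^'n\<close> is given by the set \<open>I\<close> of those
  indices that belong to \<open>x1\<close>; the indices outside \<open>I\<close> belong to \<open>x2\<close>.  Hence \<open>n1 = card I\<close> and
  \<open>n2 = card (- I)\<close>, and the case \<open>n2 = 0\<close> (\<open>I = UNIV\<close>) is included, which it would not be with
  the type \<open>real^'n1 \<times> real^'n2\<close>.
\<close>

text \<open>\<open>(\<real>^n1 - {0}) \<times> \<real>^n2\<close>, i.e. the vectors whose block \<open>x1\<close> is nonzero.\<close>

definition D1 :: "'n::finite set \<Rightarrow> (real^'n) set" where
  "D1 I = {x. \<exists>i\<in>I. x $ i \<noteq> 0}"

definition locally_integrable :: "(real \<Rightarrow> 'b::euclidean_space) \<Rightarrow> bool" where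
  "locally_integrable f \<longleftrightarrow> (\<forall>a b. set_integrable lebesgue {a..b} f)"

definition continuous_unif_in_time ::
    "(real \<Rightarrow> 'a::real_normed_vector \<Rightarrow> 'b::real_normed_vector) \<Rightarrow> bool" where
  "continuous_unif_in_time \<phi> \<longleftrightarrow>
     (\<forall>x. \<forall>\<epsilon>>0. \<exists>\<delta>>0. \<forall>z. norm (z - x) \<le> \<delta> \<longrightarrow> (\<forall>t. norm (\<phi> t z - \<phi> t x) \<le> \<epsilon>))"

text \<open>
  Local integrability of \<open>\<lambda>t. \<phi> t x\<close> is a standing assumption on \<open>\<phi>\<close> and not part of the predicate;
  without it the Lebesgue integral below defaults to \<open>0\<close>.
\<close>

definition udelta_PE :: "'n::finite set \<Rightarrow> (real \<Rightarrow> real^'n \<Rightarrow> real^'m) \<Rightarrow> bool" where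
  "udelta_PE I \<phi> \<longleftrightarrow>
     (\<forall>x\<in>D1 I. \<exists>\<delta>>0. \<exists>T>0. \<exists>\<mu>>0. \<forall>t. \<forall>z. norm (z - x) \<le> \<delta> \<longrightarrow>
        (LINT \<tau>:{t..t+T}|lebesgue. norm (\<phi> \<tau> z)) \<ge> \<mu>)"

end

theory Submission
  imports Defs
begin

text \<open>
  Only the passage from excitation at the single point \<open>x\<close> to excitation on a ball around \<open>x\<close> has
  content. Over a window of length \<open>T\<close>, a perturbation of the integrand by at most \<open>e\<close> costs at most
  \<open>e * T\<close> of the integral (\<open>set_integral_norm_perturb_ge\<close>). Continuity uniform in time gives one
  radius \<open>\<delta>\<close> on which \<open>\<phi> \<tau> z\<close> is within \<open>\<mu> / (2 * T)\<close> of \<open>\<phi> \<tau> x\<close> for all \<open>\<tau>\<close>, hence on every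
  window at once; there at least half of the lower bound \<open>\<mu>\<close> survives, with the same \<open>T\<close>.
\<close>

lemma set_integral_norm_perturb_ge:
  fixes f g :: "real \<Rightarrow> 'b::euclidean_space"
  assumes f: "set_integrable lebesgue {a..b} f" and g: "set_integrable lebesgue {a..b} g"
    and "a \<le> b" and close: "\<And>s. norm (g s - f s) \<le> e"
  shows "(LINT s:{a..b}|lebesgue. norm (f s)) - e * (b - a) \<le> (LINT s:{a..b}|lebesgue. norm (g s))"
proof -
  have const: "set_integrable lebesgue {a..b} (\<lambda>_. e)"
    using emeasure_bounded_finite[of "{a..b}"]
    by (simp add: set_integrable_def integrable_indicator_iff)
  have nf: "set_integrable lebesgue {a..b} (\<lambda>s. norm (f s))"
    and ng: "set_integrable lebesgue {a..b} (\<lambda>s. norm (g s))"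
    using f g by (auto intro: set_integrable_norm)
  have "(LINT s:{a..b}|lebesgue. norm (f s)) - e * (b - a)
      = (LINT s:{a..b}|lebesgue. norm (f s)) - (LINT s:{a..b}|lebesgue. e)"
    using \<open>a \<le> b\<close> by (simp add: set_lebesgue_integral_def mult.commute)
  also have "\<dots> = (LINT s:{a..b}|lebesgue. norm (f s) - e)"
    using set_integral_diff(2)[OF nf const] by simp
  also have "\<dots> \<le> (LINT s:{a..b}|lebesgue. norm (g s))"
  proof (rule set_integral_mono[OF set_integral_diff(1)[OF nf const] ng])
    fix s
    show "norm (f s) - e \<le> norm (g s)"
      using close[of s] norm_triangle_ineq2[of "f s" "g s"] by (simp add: norm_minus_commute)
  qed
  finally show ?thesis .
qed

theorem lemma1:
  fixes \<phi> :: "real \<Rightarrow> real^'n \<Rightarrow> real^'m" and I :: "'n set"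
  assumes "\<And>x. locally_integrable (\<lambda>t. \<phi> t x)"
    and "continuous_unif_in_time \<phi>"
  shows "udelta_PE I \<phi> \<longleftrightarrow>
    (\<forall>x\<in>D1 I. \<exists>T>0. \<exists>\<mu>>0. \<forall>t. (LINT \<tau>:{t..t+T}|lebesgue. norm (\<phi> \<tau> x)) \<ge> \<mu>)"
    (is "_ \<longleftrightarrow> ?pointwise")
proof
  assume PE: "udelta_PE I \<phi>"
  show ?pointwise
  proof
    fix x assume "x \<in> D1 I"
    then obtain \<delta> T \<mu> where "\<delta> > 0" "T > 0" "\<mu> > 0"
      and "\<And>t z. norm (z - x) \<le> \<delta> \<Longrightarrow> (LINT \<tau>:{t..t+T}|lebesgue. norm (\<phi> \<tau> z)) \<ge> \<mu>"
      using PE unfolding udelta_PE_def by meson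
    moreover from \<open>\<delta> > 0\<close> have "norm (x - x) \<le> \<delta>" by simp
    ultimately show "\<exists>T>0. \<exists>\<mu>>0. \<forall>t. (LINT \<tau>:{t..t+T}|lebesgue. norm (\<phi> \<tau> x)) \<ge> \<mu>"
      by blast
  qed
next
  assume pw: ?pointwise
  have int: "set_integrable lebesgue {a..b} (\<lambda>t. \<phi> t x)" for a b x
    using assms(1) unfolding locally_integrable_def by blast
  show "udelta_PE I \<phi>"
    unfolding udelta_PE_def
  proof
    fix x assume "x \<in> D1 I"
    then obtain T \<mu> where "T > 0" "\<mu> > 0"
      and lower: "\<And>t. (LINT \<tau>:{t..t+T}|lebesgue. norm (\<phi> \<tau> x)) \<ge> \<mu>"
      using pw by meson
    then have "\<mu> / (2 * T) > 0" by simp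
    then obtain \<delta> where "\<delta> > 0"
      and \<delta>: "\<And>z t. norm (z - x) \<le> \<delta> \<Longrightarrow> norm (\<phi> t z - \<phi> t x) \<le> \<mu> / (2 * T)"
      using assms(2) unfolding continuous_unif_in_time_def by meson
    have "(LINT \<tau>:{t..t+T}|lebesgue. norm (\<phi> \<tau> z)) \<ge> \<mu> / 2" if "norm (z - x) \<le> \<delta>" for t z
    proof -
      have "(LINT \<tau>:{t..t+T}|lebesgue. norm (\<phi> \<tau> x)) - \<mu> / (2 * T) * (t + T - t)
          \<le> (LINT \<tau>:{t..t+T}|lebesgue. norm (\<phi> \<tau> z))"
        using \<open>T > 0\<close> \<delta>[OF that] by (intro set_integral_norm_perturb_ge int) auto
      moreover have "\<mu> / (2 * T) * (t + T - t) = \<mu> / 2"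
        using \<open>T > 0\<close> by simp
      ultimately show ?thesis
        using lower[of t] by linarith
    qed
    with \<open>\<delta> > 0\<close> \<open>T > 0\<close> \<open>\<mu> > 0\<close> half_gt_zero[OF \<open>\<mu> > 0\<close>]
    show "\<exists>\<delta>>0. \<exists>T>0. \<exists>\<mu>>0. \<forall>t z. norm (z - x) \<le> \<delta> \<longrightarrow>
        (LINT \<tau>:{t..t+T}|lebesgue. norm (\<phi> \<tau> z)) \<ge> \<mu>"
      by blast
  qed
qed

end
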